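(* Let $X$ be a Banach space and let $(\lambda,\|\cdot\|_\lambda)$ be a normal $AK$-$BK$ sequence space. Then $$\lambda^{s}(X)\subset\lambda^{mid}(X)\subset\lambda^{w}(X),$$ and both inclusion maps are continuous with norm at most $1$; that is, $\|(x_n)_n\|_\lambda^{mid}\le\|(x_n)_n\|_\lambda^{s}$ for all $(x_n)_n\in\lambda^s(X)$ and $\|(x_n)_n\|_\lambda^{w}\le\|(x_n)_n\|_\lambda^{mid}$ for all $(x_n)_n\in\lambda^{mid}(X)$.
   Context: $\mathbb{K}$ is $\mathbb{R}$ or $\mathbb{C}$; $e_n$ is the $n$-th unit vector in the space $\omega$ of all scalar sequences and $\phi=\mathrm{span}\{e_n:n\ge1\}$. A sequence space is a linear subspace $\lambda\subseteq\omega$ with $\phi\subseteq\lambda$. It is normal if $(\beta_n)_n\in\lambda$ whenever $|\beta_n|\le|\alpha_n|$ for all $n$ and some $(\alpha_n)_n\in\lambda$. A $BK$-space is a sequence space with a complete norm $\|\cdot\|_\lambda$ for which all coordinate projections are continuous; it is an $AK$-space if $\sum_{n=1}^m\alpha_ne_n\to(\alpha_n)_n$ in $\lambda$ as $m\to\infty$ for every $(\alpha_n)_n\in\lambda$. Standing assumptions: the norm of a normal space is monotone ($|\alpha_n|\le|\beta_n|$ for all $n$ implies $\|(\alpha_n)_n\|_\lambda\le\|(\beta_n)_n\|_\lambda$), and $0<\sup_n\|e_n\|_\lambda<\infty$. $B_X$ is the closed unit ball and $X^*$ the topological dual of $X$. Define $\lambda^s(X)=\{(x_n)_n\subset X:(\|x_n\|)_n\in\lambda\}$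 with $\|(x_n)_n\|_\lambda^s=\|(\|x_n\|)_n\|_\lambda$; $\lambda^w(X)=\{(x_n)_n\subset X:(f(x_n))_n\in\lambda\ \forall f\in X^*\}$ with $\|(x_n)_n\|_\lambda^w=\sup_{f\in B_{X^*}}\|(f(x_n))_n\|_\lambda$; $\lambda^{w^*}(X^* )=\{(f_n)_n\subset X^*:(f_n(x))_n\in\lambda\ \forall x\in X\}$ with $\|(f_n)_n\|_\lambda^{w^*}=\sup_{x\in B_X}\|(f_n(x))_n\|_\lambda$. $\lambda^{mid}(X)$ is the set of sequences $(x_n)_n\subset X$ such that $\big((f_j(x_n))_j\big)_n\in\lambda^s(\lambda)$ for every $(f_j)_j\in\lambda^{w^*}(X^* )$, with norm $\|(x_n)_n\|_\lambda^{mid}=\sup_{(f_j)_j\in B_{\lambda^{w^*}(X^* )}}\big\|\big(\|(f_j(x_n))_j\|_\lambda\big)_n\big\|_\lambda$. *)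

theory Defs
  imports "HOL-Analysis.Analysis" "HOL-Library.Function_Algebras"
begin

text \<open>
  The scalar field is a type of class \<open>{real_normed_field, banach}\<close>. Both \<open>real\<close> and
  \<open>complex\<close> are instances, and by the Gelfand--Mazur theorem every instance is
  isometrically isomorphic to one of them. Sequences are indexed from \<open>0\<close>.
\<close>

definition seq_scale :: "'k::field \<Rightarrow> (nat \<Rightarrow> 'k) \<Rightarrow> nat \<Rightarrow> 'k" where
  "seq_scale c \<alpha> = (\<lambda>n. c * \<alpha> n)"

interpretation omega: vector_space "seq_scale :: 'k::field \<Rightarrow> _"
  by unfold_locales (auto simp: seq_scale_def fun_eq_iff algebra_simps)

definition unit_seq :: "nat \<Rightarrow> nat \<Rightarrow> 'k::field" where
  "unit_seq n = (\<lambda>k. if k = n then 1 else 0)"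

definition phi :: "(nat \<Rightarrow> 'k::field) set" where
  "phi = omega.span (range unit_seq)"

text \<open>
  The library's locale \<open>Metric_space\<close> requires nonnegativity and symmetry outside the carrier
  as well, hence the default value \<open>0\<close> there.
\<close>

definition seq_dist ::
  "(nat \<Rightarrow> 'k::field) set \<Rightarrow> ((nat \<Rightarrow> 'k) \<Rightarrow> real) \<Rightarrow> (nat \<Rightarrow> 'k) \<Rightarrow> (nat \<Rightarrow> 'k) \<Rightarrow> real" where
  "seq_dist \<Lambda> N \<alpha> \<beta> = (if \<alpha> \<in> \<Lambda> \<and> \<beta> \<in> \<Lambda> then N (\<alpha> - \<beta>) else 0)"

locale sequence_space =
  fixes \<Lambda> :: "(nat \<Rightarrow> 'k::{real_normed_field, banach}) set"
  assumes subspace: "omega.subspace \<Lambda>"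
    and phi_subset: "phi \<subseteq> \<Lambda>"

text \<open>The norm is a total function whose values outside \<open>\<Lambda>\<close> are irrelevant.\<close>

locale BK_space = sequence_space \<Lambda>
  for \<Lambda> :: "(nat \<Rightarrow> 'k::{real_normed_field, banach}) set" +
  fixes N :: "(nat \<Rightarrow> 'k) \<Rightarrow> real"
  assumes N_nonneg: "\<alpha> \<in> \<Lambda> \<Longrightarrow> 0 \<le> N \<alpha>"
    and N_eq_0_iff: "\<alpha> \<in> \<Lambda> \<Longrightarrow> N \<alpha> = 0 \<longleftrightarrow> \<alpha> = 0"
    and N_triangle: "\<alpha> \<in> \<Lambda> \<Longrightarrow> \<beta> \<in> \<Lambda> \<Longrightarrow> N (\<alpha> + \<beta>) \<le> N \<alpha> + N \<beta>"
    and N_scale: "\<alpha> \<in> \<Lambda> \<Longrightarrow> N (seq_scale c \<alpha>) = norm c * N \<alpha>"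
    and N_complete: "Metric_space.mcomplete \<Lambda> (seq_dist \<Lambda> N)"
    and coordinate_continuous:
      "continuous_map (Metric_space.mtopology \<Lambda> (seq_dist \<Lambda> N)) euclidean (\<lambda>\<alpha>. \<alpha> n)"

lemma (in BK_space) Metric_space_seq_dist: "Metric_space \<Lambda> (seq_dist \<Lambda> N)"
proof -
  have diff: "\<alpha> - \<beta> \<in> \<Lambda>" if "\<alpha> \<in> \<Lambda>" "\<beta> \<in> \<Lambda>" for \<alpha> \<beta>
    using omega.subspace_diff[OF subspace that] .
  have comm: "N (\<alpha> - \<beta>) = N (\<beta> - \<alpha>)" if "\<alpha> \<in> \<Lambda>" "\<beta> \<in> \<Lambda>" for \<alpha> \<beta>
  proof -
    have "\<alpha> - \<beta> = seq_scale (- 1) (\<beta> - \<alpha>)" by (simp add: seq_scale_def fun_eq_iff)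
    then show ?thesis using N_scale[OF diff[OF that(2,1)], of "- 1"] by simp
  qed
  have tri: "N (\<alpha> - \<gamma>) \<le> N (\<alpha> - \<beta>) + N (\<beta> - \<gamma>)" if "\<alpha> \<in> \<Lambda>" "\<beta> \<in> \<Lambda>" "\<gamma> \<in> \<Lambda>" for \<alpha> \<beta> \<gamma>
    using N_triangle[OF diff[OF that(1,2)] diff[OF that(2,3)]] by simp
  show ?thesis
    by unfold_locales (auto simp: seq_dist_def N_nonneg diff comm N_eq_0_iff tri)
qed

locale AK_BK_space = BK_space +
  assumes AK: "\<alpha> \<in> \<Lambda> \<Longrightarrow>
    limitin (Metric_space.mtopology \<Lambda> (seq_dist \<Lambda> N))
      (\<lambda>m. \<Sum>n<m. seq_scale (\<alpha> n) (unit_seq n)) \<alpha> sequentially"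

text \<open>The last three assumptions are the standing ones on the norm of a normal space.\<close>

locale normal_AK_BK_space = AK_BK_space +
  assumes normal: "\<alpha> \<in> \<Lambda> \<Longrightarrow> (\<And>n. norm (\<beta> n) \<le> norm (\<alpha> n)) \<Longrightarrow> \<beta> \<in> \<Lambda>"
    and N_mono: "\<alpha> \<in> \<Lambda> \<Longrightarrow> \<beta> \<in> \<Lambda> \<Longrightarrow> (\<And>n. norm (\<alpha> n) \<le> norm (\<beta> n)) \<Longrightarrow> N \<alpha> \<le> N \<beta>"
    and N_unit_bdd: "bdd_above (range (\<lambda>n. N (unit_seq n)))"
    and N_unit_pos: "0 < (SUP n. N (unit_seq n))"

text \<open>
  A Banach space over the scalar field \<open>'k\<close>: its underlying real Banach space is the type
  \<open>'x\<close>, and \<open>smul\<close> is the multiplication by scalars from \<open>'k\<close>. For \<open>'k = real\<close> this forces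
  \<open>smul = scaleR\<close>.
\<close>

locale banach_space_over = vector_space smul
  for smul :: "'k::{real_normed_field, banach} \<Rightarrow> 'x::banach \<Rightarrow> 'x" +
  assumes smul_of_real: "smul (of_real r) x = r *\<^sub>R x"
    and norm_smul: "norm (smul c x) = norm c * norm x"

definition dual :: "('k::{real_normed_field, banach} \<Rightarrow> 'x::banach \<Rightarrow> 'x) \<Rightarrow> ('x \<Rightarrow> 'k) set" where
  "dual smul = {f. Vector_Spaces.linear smul (*) f \<and> continuous_on UNIV f}"

text \<open>
  The space \<open>\<lambda>\<^sup>s(C)\<close> for a normed space with carrier \<open>C\<close> and norm \<open>nrm\<close>; below it is used both
  for \<open>X\<close> (with \<open>C = UNIV\<close> and \<open>nrm = norm\<close>) and for \<open>\<lambda>\<close> itself.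
\<close>

definition strong_seqs ::
  "(nat \<Rightarrow> 'k::{real_normed_field, banach}) set \<Rightarrow> 'a set \<Rightarrow> ('a \<Rightarrow> real) \<Rightarrow> (nat \<Rightarrow> 'a) set" where
  "strong_seqs \<Lambda> C nrm = {x. (\<forall>n. x n \<in> C) \<and> (\<lambda>n. of_real (nrm (x n))) \<in> \<Lambda>}"

definition strong_norm ::
  "((nat \<Rightarrow> 'k::{real_normed_field, banach}) \<Rightarrow> real) \<Rightarrow> ('a \<Rightarrow> real) \<Rightarrow> (nat \<Rightarrow> 'a) \<Rightarrow> real" where
  "strong_norm N nrm x = N (\<lambda>n. of_real (nrm (x n)))"

text \<open>
  The norms defined by suprema take values in \<open>ereal\<close>, so that the supremum is the true one
  without a prior proof of boundedness.
\<close>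

definition weak_seqs ::
  "(nat \<Rightarrow> 'k::{real_normed_field, banach}) set \<Rightarrow> ('k \<Rightarrow> 'x::banach \<Rightarrow> 'x) \<Rightarrow> (nat \<Rightarrow> 'x) set" where
  "weak_seqs \<Lambda> smul = {x. \<forall>f\<in>dual smul. (\<lambda>n. f (x n)) \<in> \<Lambda>}"

definition weak_norm ::
  "((nat \<Rightarrow> 'k::{real_normed_field, banach}) \<Rightarrow> real) \<Rightarrow> ('k \<Rightarrow> 'x::banach \<Rightarrow> 'x) \<Rightarrow>
    (nat \<Rightarrow> 'x) \<Rightarrow> ereal" where
  "weak_norm N smul x = (SUP f\<in>{f \<in> dual smul. onorm f \<le> 1}. ereal (N (\<lambda>n. f (x n))))"

definition weakstar_seqs ::
  "(nat \<Rightarrow> 'k::{real_normed_field, banach}) set \<Rightarrow> ('k \<Rightarrow> 'x::banach \<Rightarrow> 'x) \<Rightarrow>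
    (nat \<Rightarrow> 'x \<Rightarrow> 'k) set" where
  "weakstar_seqs \<Lambda> smul = {f. (\<forall>n. f n \<in> dual smul) \<and> (\<forall>x. (\<lambda>n. f n x) \<in> \<Lambda>)}"

definition weakstar_norm ::
  "((nat \<Rightarrow> 'k::{real_normed_field, banach}) \<Rightarrow> real) \<Rightarrow> (nat \<Rightarrow> 'x::banach \<Rightarrow> 'k) \<Rightarrow> ereal" where
  "weakstar_norm N f = (SUP x\<in>cball 0 1. ereal (N (\<lambda>n. f n x)))"

definition mid_seqs ::
  "(nat \<Rightarrow> 'k::{real_normed_field, banach}) set \<Rightarrow> ((nat \<Rightarrow> 'k) \<Rightarrow> real) \<Rightarrow>
    ('k \<Rightarrow> 'x::banach \<Rightarrow> 'x) \<Rightarrow> (nat \<Rightarrow> 'x) set" where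
  "mid_seqs \<Lambda> N smul =
    {x. \<forall>f\<in>weakstar_seqs \<Lambda> smul. (\<lambda>n j. f j (x n)) \<in> strong_seqs \<Lambda> \<Lambda> N}"

definition mid_norm ::
  "(nat \<Rightarrow> 'k::{real_normed_field, banach}) set \<Rightarrow> ((nat \<Rightarrow> 'k) \<Rightarrow> real) \<Rightarrow>
    ('k \<Rightarrow> 'x::banach \<Rightarrow> 'x) \<Rightarrow> (nat \<Rightarrow> 'x) \<Rightarrow> ereal" where
  "mid_norm \<Lambda> N smul x =
    (SUP f\<in>{f \<in> weakstar_seqs \<Lambda> smul. weakstar_norm N f \<le> 1}.
      ereal (strong_norm N N (\<lambda>n j. f j (x n))))"

end

theory Submission
  imports Defs
begin

text \<open>
  Every \<open>f\<close> in \<open>\<lambda>\<^sup>w\<^sup>*(X\<^sup>*)\<close> has finite norm \<open>r\<close>, so \<open>(\<parallel>(f\<^sub>j(x\<^sub>n))\<^sub>j\<parallel>)\<^sub>n\<close> is dominated by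
  \<open>r (\<parallel>x\<^sub>n\<parallel>)\<^sub>n\<close>, and normality gives the first inclusion. For the second, a functional \<open>f\<close> is
  placed in one coordinate, divided by the norm of the unit vector there.
  Finiteness of the norms on \<open>\<lambda>\<^sup>w\<^sup>*(X\<^sup>*)\<close> and on \<open>\<lambda>\<^sup>m\<^sup>i\<^sup>d(X)\<close> is a uniform boundedness argument:
  each is a supremum of pointwise bounded continuous seminorms, the norms of truncations, on a
  complete space (\<open>X\<close> and \<open>\<lambda>\<^sup>w\<^sup>*(X\<^sup>*)\<close>, respectively).
\<close>

section \<open>Uniform boundedness by nested balls\<close>

text \<open>
  The uniform boundedness principle, with the norm \<open>Q\<close> allowed to be \<open>\<infinity>\<close> because it is applied to
  the supremum norm on \<open>\<lambda>\<^sup>w\<^sup>*(X\<^sup>*)\<close>. In the proof, a state \<open>(x, r, i)\<close> records a point with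
  \<open>q i x\<close> large and a radius \<open>r\<close> such that \<open>q i\<close> changes by at most \<open>1\<close> within distance \<open>r\<close>; the limit
  of nested balls then violates pointwise boundedness.
\<close>

lemma gliding_hump:
  fixes V :: "'v::ab_group_add set" and Q :: "'v \<Rightarrow> ereal" and q :: "'i \<Rightarrow> 'v \<Rightarrow> real"
  assumes V_add: "\<And>u v. u \<in> V \<Longrightarrow> v \<in> V \<Longrightarrow> u + v \<in> V"
    and V_diff: "\<And>u v. u \<in> V \<Longrightarrow> v \<in> V \<Longrightarrow> u - v \<in> V"
    and Q_zero: "Q 0 \<le> 0"
    and Q_add: "\<And>u v r s. u \<in> V \<Longrightarrow> v \<in> V \<Longrightarrow> Q u \<le> ereal r \<Longrightarrow> Q v \<le> ereal s
      \<Longrightarrow> Q (u + v) \<le> ereal (r + s)"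
    and complete: "\<And>x d. (\<And>n. x n \<in> V) \<Longrightarrow> (\<And>m n. n \<le> m \<Longrightarrow> Q (x m - x n) \<le> ereal (d n))
      \<Longrightarrow> d \<longlonglongrightarrow> 0 \<Longrightarrow> \<exists>l\<in>V. \<forall>n. Q (l - x n) \<le> ereal (d n)"
    and q_add: "\<And>i u v. u \<in> V \<Longrightarrow> v \<in> V \<Longrightarrow> q i (u + v) \<le> q i u + q i v"
    and q_minus: "\<And>i v. v \<in> V \<Longrightarrow> q i (- v) = q i v"
    and q_bound: "\<And>i v r. v \<in> V \<Longrightarrow> Q v \<le> ereal r \<Longrightarrow> q i v \<le> C i * r"
    and pointwise: "\<And>v. v \<in> V \<Longrightarrow> \<exists>b. \<forall>i. q i v \<le> b"
  shows "\<exists>r>0. \<exists>K. \<forall>v\<in>V. Q v \<le> ereal r \<longrightarrow> (\<forall>i. q i v \<le> K)"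
proof (rule ccontr)
  assume "\<not> ?thesis"
  then have hump: "\<exists>v\<in>V. Q v \<le> ereal r \<and> (\<exists>i. K < q i v)" if "0 < r" for r K
    using that by (meson not_le)
  define P where "P n s = (case s of (x, r, i) \<Rightarrow>
    x \<in> V \<and> 0 < r \<and> C i * r \<le> 1 \<and> real n < q i x)" for n s
  define R where "R s t = (case s of (x, r, i) \<Rightarrow> case t of (x', r', i') \<Rightarrow>
    Q (x' - x) \<le> ereal (r / 2) \<and> r' \<le> r / 2)" for s t :: "'v \<times> real \<times> 'i"
  have step: "\<exists>t. P n t \<and> R (x, r, i) t" if x: "x \<in> V" and r: "0 < r" for n x r i
  proof -
    \<comment> \<open>Here \<open>b\<close> bounds every \<open>q i x\<close>. Since
      \<open>q j v \<le> q j (v + x) + q j x\<close>, a hump above \<open>real n + b\<close> at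
      \<open>v\<close> leaves more than \<open>real n\<close> at the new centre
      \<open>v + x\<close>.\<close>
    obtain b where b: "\<And>i. q i x \<le> b" using pointwise[OF x] by blast
    obtain v j where v: "v \<in> V" "Q v \<le> ereal (r / 2)" and j: "real n + b < q j v"
      using hump[of "r / 2" "real n + b"] r by auto
    \<comment> \<open>The first bound makes the radii decay geometrically, the second gives
      \<open>C j * r' \<le> 1\<close>; the absolute value is there because \<open>C j\<close> may
      have either sign.\<close>
    define r' where "r' = min (r / 2) (1 / (\<bar>C j\<bar> + 1))"
    have "q j (v + x + - x) \<le> q j (v + x) + q j (- x)"
      using v(1) x V_diff[OF x x] V_diff[of 0 x] V_add by (intro q_add) auto
    then have "q j v \<le> q j (v + x) + q j x" by (simp add: q_minus x)
    with j b[of j] have "real n < q j (v + x)" by linarith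
    moreover have "0 < r'" using r by (simp add: r'_def)
    moreover have "C j * r' \<le> 1"
    proof -
      have "C j * r' \<le> \<bar>C j\<bar> * (1 / (\<bar>C j\<bar> + 1))"
        using \<open>0 < r'\<close> by (intro mult_mono) (auto simp: r'_def)
      also have "\<dots> \<le> 1" by (simp add: field_simps)
      finally show ?thesis .
    qed
    ultimately have "P n (v + x, r', j) \<and> R (x, r, i) (v + x, r', j)"
      using v x V_add by (simp add: P_def R_def r'_def)
    then show ?thesis by blast
  qed
  have "\<exists>s. P 0 s"
  proof -
    \<comment> \<open>Any point with radius 1 can start the recursion: \<open>step\<close> asks for
      membership and a positive radius, not for \<open>P\<close>.\<close>
    obtain v where "v \<in> V" using hump[of 1] by auto
    then show ?thesis using step[of v 1 0] by fastforce
  qed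
  moreover have "\<exists>t. P (Suc n) t \<and> R s t" if "P n s" for n s
    using that step[of "fst s" "fst (snd s)" "Suc n" "snd (snd s)"] by (cases s) (simp add: P_def)
  ultimately obtain s where s: "\<And>n. P n (s n)" "\<And>n. R (s n) (s (Suc n))"
    using dependent_nat_choice[of P "\<lambda>_. R"] by metis
  define x where "x n = fst (s n)" for n
  define r where "r n = fst (snd (s n))" for n
  define i where "i n = snd (snd (s n))" for n
  have P: "x n \<in> V" "0 < r n" "C (i n) * r n \<le> 1" "real n < q (i n) (x n)" for n
    using s(1)[of n] by (auto simp: P_def x_def r_def i_def split: prod.splits)
  have R: "Q (x (Suc n) - x n) \<le> ereal (r n / 2)" "r (Suc n) \<le> r n / 2" for n
    using s(2)[of n] by (auto simp: R_def x_def r_def split: prod.splits)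
  \<comment> \<open>The bound \<open>r n - r m\<close> instead of \<open>r n\<close> makes the
    induction close: one more step costs \<open>r m / 2\<close>, which is at most
    \<open>r m - r (Suc m)\<close>.\<close>
  have "Q (x m - x n) \<le> ereal (r n - r m)" if "n \<le> m" for m n
    using that
  proof (induction m rule: dec_induct)
    case base
    then show ?case using Q_zero by (simp add: zero_ereal_def)
  next
    case (step m)
    have "Q ((x m - x n) + (x (Suc m) - x m)) \<le> ereal ((r n - r m) + r m / 2)"
      using step.IH R(1) P(1) V_diff by (intro Q_add) auto
    also have "\<dots> \<le> ereal (r n - r (Suc m))" using R(2)[of m] by simp
    finally show ?case by (simp add: algebra_simps)
  qed
  then have cauchy: "Q (x m - x n) \<le> ereal (r n)" if "n \<le> m" for m n
    using that P(2)[of m] by (fastforce intro: order_trans)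
  have "r n \<le> r 0 * (1 / 2) ^ n" for n
  proof (induction n)
    case (Suc n)
    then show ?case using R(2)[of n] by simp
  qed simp
  then have "r \<longlonglongrightarrow> 0"
    using P(2) by (intro tendsto_sandwich[of "\<lambda>_. 0" r _ "\<lambda>n. r 0 * (1 / 2) ^ n"])
      (auto intro!: always_eventually less_imp_le tendsto_mult_right_zero LIMSEQ_realpow_zero)
  then obtain l where l: "l \<in> V" "\<And>n. Q (l - x n) \<le> ereal (r n)"
    using complete[where x = x, OF P(1) cauchy] by blast
  obtain b where b: "\<And>i. q i l \<le> b" using pointwise[OF l(1)] by blast
  \<comment> \<open>Writing \<open>x n\<close> as \<open>l - (l - x n)\<close>, the second term
    contributes at most \<open>C (i n) * r n \<le> 1\<close>, whereas the hump at \<open>x n\<close>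
    exceeds \<open>real n\<close>.\<close>
  have "real n < b + 1" for n
  proof -
    have d: "l - x n \<in> V" using V_diff l(1) P(1) .
    have "q (i n) (l + - (l - x n)) \<le> q (i n) l + q (i n) (- (l - x n))"
      using l(1) P(1) d V_diff[of "l - l" "l - x n"] V_diff[of l l] by (intro q_add) auto
    also have "\<dots> \<le> b + 1"
      using b[of "i n"] q_bound[OF d l(2), of "i n"] P(3)[of n] q_minus[OF d, of "i n"] by linarith
    finally show ?thesis using P(4)[of n] by simp
  qed
  then show False using reals_Archimedean2[of "b + 1"] by (meson less_asym)
qed

section \<open>Domination, truncation and completeness in the sequence space\<close>

context normal_AK_BK_space
begin

interpretation M: Metric_space \<Lambda> "seq_dist \<Lambda> N"
  by (rule Metric_space_seq_dist)

lemmas add_closed = omega.subspace_add[OF subspace]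
  and diff_closed = omega.subspace_diff[OF subspace]
  and scale_closed = omega.subspace_scale[OF subspace]
  and zero_closed = omega.subspace_0[OF subspace]

lemma unit_closed: "unit_seq n \<in> \<Lambda>"
  using phi_subset omega.span_base[of "unit_seq n" "range unit_seq"] by (auto simp: phi_def)

lemma N_unit: "0 < N (unit_seq n)"
proof -
  have "unit_seq n \<noteq> (0 :: nat \<Rightarrow> 'a)" by (auto simp: unit_seq_def fun_eq_iff)
  then show ?thesis using N_nonneg[OF unit_closed] N_eq_0_iff[OF unit_closed]
    by (metis less_eq_real_def)
qed

lemma N_zero: "N 0 = 0"
  using N_eq_0_iff[OF zero_closed] by simp

text \<open>Normality supplies the membership of \<open>\<alpha>\<close> that \<open>N_mono\<close>
  asks for.\<close>

lemma N_le:
  assumes "\<beta> \<in> \<Lambda>" "\<And>n. norm (\<alpha> n) \<le> norm (\<beta> n)"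
  shows "N \<alpha> \<le> N \<beta>"
  using assms normal N_mono by blast

lemma N_cong_norm:
  assumes "\<beta> \<in> \<Lambda>" "\<And>n. norm (\<alpha> n) = norm (\<beta> n)"
  shows "N \<alpha> = N \<beta>"
proof -
  have "\<alpha> \<in> \<Lambda>" using normal[OF assms(1)] assms(2) by simp
  then show ?thesis using assms by (intro antisym N_le) auto
qed

lemma N_minus: "\<alpha> \<in> \<Lambda> \<Longrightarrow> N (- \<alpha>) = N \<alpha>"
  by (rule N_cong_norm) auto

text \<open>The sequence \<alpha> dominates its single term \<open>\<alpha> n\<close> times the unit
  vector. This is a quantitative form of the continuity of coordinates.\<close>

lemma coordinate_le: "\<alpha> \<in> \<Lambda> \<Longrightarrow> norm (\<alpha> n) * N (unit_seq n) \<le> N \<alpha>"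
  using N_le[of \<alpha> "seq_scale (\<alpha> n) (unit_seq n)"] N_scale[OF unit_closed, of "\<alpha> n" n]
  by (auto simp: seq_scale_def unit_seq_def)

text \<open>The coordinatewise form makes domination by \<alpha> visible;
  \<open>truncation_eq_sum\<close> identifies it with the partial sum in the AK property.\<close>

definition truncation :: "nat \<Rightarrow> (nat \<Rightarrow> 'a) \<Rightarrow> nat \<Rightarrow> 'a" where
  "truncation m \<alpha> = (\<lambda>n. if n < m then \<alpha> n else 0)"

lemma truncation_0: "truncation 0 \<alpha> = 0"
  by (simp add: truncation_def fun_eq_iff)

lemma truncation_Suc:
  "truncation (Suc m) \<alpha> = truncation m \<alpha> + seq_scale (\<alpha> m) (unit_seq m)"
  by (auto simp: truncation_def seq_scale_def unit_seq_def fun_eq_iff less_Suc_eq)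

lemma truncation_eq_sum: "truncation m \<alpha> = (\<Sum>n<m. seq_scale (\<alpha> n) (unit_seq n))"
  by (induction m) (simp_all add: truncation_0 truncation_Suc)

lemma truncation_add: "truncation m (\<alpha> + \<beta>) = truncation m \<alpha> + truncation m \<beta>"
  by (auto simp: truncation_def fun_eq_iff)

lemma truncation_closed: "truncation m \<alpha> \<in> \<Lambda>"
proof (induction m)
  case 0
  show ?case unfolding truncation_0 by (rule zero_closed)
next
  case (Suc m)
  then show ?case unfolding truncation_Suc by (intro add_closed scale_closed unit_closed)
qed

text \<open>The triangle inequality over finitely many unit vectors reduces the norm to coordinates.
  This yields the constants \<open>C\<close> in both applications of
  \<open>gliding_hump\<close>.\<close>

lemma N_truncation_le_sum: "N (truncation m \<alpha>) \<le> (\<Sum>n<m. norm (\<alpha> n) * N (unit_seq n))"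
proof (induction m)
  case 0
  show ?case unfolding truncation_0 N_zero by simp
next
  case (Suc m)
  then show ?case
    using N_triangle[OF truncation_closed[of m \<alpha>] scale_closed[OF unit_closed], of "\<alpha> m" m]
    unfolding truncation_Suc N_scale[OF unit_closed] sum.lessThan_Suc by linarith
qed

lemma N_truncation_le: "\<alpha> \<in> \<Lambda> \<Longrightarrow> N (truncation m \<alpha>) \<le> N \<alpha>"
  by (rule N_le) (auto simp: truncation_def)

text \<open>By AK the truncations converge to \<alpha> in norm, so a uniform bound survives the
  limit.\<close>

lemma N_le_if_truncations_le:
  assumes "\<alpha> \<in> \<Lambda>" "\<And>m. N (truncation m \<alpha>) \<le> K"
  shows "N \<alpha> \<le> K"
proof (rule field_le_epsilon)
  fix e :: real assume "0 < e"
  then obtain m where m: "seq_dist \<Lambda> N (truncation m \<alpha>) \<alpha> < e"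
    using AK[OF assms(1)] unfolding M.limit_metric_sequentially truncation_eq_sum by blast
  have d: "truncation m \<alpha> - \<alpha> \<in> \<Lambda>" using assms(1) by (intro diff_closed truncation_closed)
  have "N (truncation m \<alpha> + - (truncation m \<alpha> - \<alpha>))
      \<le> N (truncation m \<alpha>) + N (- (truncation m \<alpha> - \<alpha>))"
    using diff_closed[OF zero_closed d] by (intro N_triangle truncation_closed) simp
  then show "N \<alpha> \<le> K + e"
    using m assms(2)[of m] N_minus[OF d] by (simp add: seq_dist_def assms(1) truncation_closed)
qed

text \<open>Letting \<open>m\<close> grow in the Cauchy estimate keeps the rate \<open>d n\<close>.
  The coordinate limits are recorded because \<open>W_complete\<close> derives linearity of the
  limit functionals from them.\<close>

lemma complete_with_rate:
  assumes x: "\<And>n. x n \<in> \<Lambda>"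
    and cauchy: "\<And>m n. n \<le> m \<Longrightarrow> N (x m - x n) \<le> d n" and d: "d \<longlonglongrightarrow> 0"
  shows "\<exists>l\<in>\<Lambda>. (\<forall>n. N (l - x n) \<le> d n) \<and> (\<forall>j. (\<lambda>n. x n j) \<longlonglongrightarrow> l j)"
proof -
  have sym: "N (x m - x n) = N (x n - x m)" for m n
    using N_minus[OF diff_closed[OF x x], of m n] by simp
  have "M.MCauchy x"
    unfolding M.MCauchy_def
  proof (intro conjI allI impI)
    show "range x \<subseteq> \<Lambda>" using x by blast
    fix e :: real assume "0 < e"
    then obtain k where k: "\<And>n. n \<ge> k \<Longrightarrow> d n < e"
      using order_tendstoD(2)[OF d] by (auto simp: eventually_sequentially)
    have "seq_dist \<Lambda> N (x m) (x n) < e" if "k \<le> m" "k \<le> n" for m n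
      using that cauchy[of n m] cauchy[of m n] k[of m] k[of n] sym[of m n] x
      by (cases "n \<le> m") (auto simp: seq_dist_def)
    then show "\<exists>k. \<forall>n n'. k \<le> n \<longrightarrow> k \<le> n' \<longrightarrow> seq_dist \<Lambda> N (x n) (x n') < e" by blast
  qed
  then obtain l where l: "limitin M.mtopology x l sequentially"
    using N_complete by (auto simp: M.mcomplete_def)
  then have lin: "l \<in> \<Lambda>" by (simp add: M.limit_metric_sequentially)
  have close: "\<exists>k. \<forall>n\<ge>k. N (x n - l) < e" if "0 < e" for e
    using l that x lin by (simp add: M.limit_metric_sequentially seq_dist_def)
  have "N (l - x n) \<le> d n" for n
  proof (rule field_le_epsilon)
    fix e :: real assume "0 < e"
    then obtain k where k: "\<And>n. n \<ge> k \<Longrightarrow> N (x n - l) < e" using close by blast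
    define m where "m = max k n"
    have "N ((l - x m) + (x m - x n)) \<le> N (l - x m) + N (x m - x n)"
      using lin x by (intro N_triangle diff_closed)
    moreover have "N (l - x m) = N (x m - l)"
      using N_minus[OF diff_closed[OF x lin], of m] by simp
    ultimately show "N (l - x n) \<le> d n + e"
      using k[of m] cauchy[of n m] by (simp add: m_def)
  qed
  moreover have "(\<lambda>n. x n j) \<longlonglongrightarrow> l j" for j
  proof (rule LIMSEQ_I)
    fix e :: real assume "0 < e"
    \<comment> \<open>The factor \<open>N (unit_seq j)\<close> compensates the one lost in
      \<open>coordinate_le\<close>.\<close>
    then obtain k where k: "\<And>n. n \<ge> k \<Longrightarrow> N (x n - l) < e * N (unit_seq j)"
      using close[of "e * N (unit_seq j)"] N_unit[of j] by auto
    have "norm (x n j - l j) < e" if "k \<le> n" for n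
    proof -
      have "norm (x n j - l j) * N (unit_seq j) < e * N (unit_seq j)"
        using coordinate_le[OF diff_closed[OF x lin], of n j] k[OF that] by simp
      then show ?thesis using N_unit[of j] by simp
    qed
    then show "\<exists>k. \<forall>n\<ge>k. norm (x n j - l j) < e" by blast
  qed
  ultimately show ?thesis using lin by blast
qed

end


section \<open>Continuous functionals over the scalar field\<close>

lemma (in banach_space_over) dual_add: "f \<in> dual smul \<Longrightarrow> f (x + y) = f x + f y"
  by (auto simp: dual_def Vector_Spaces.linear_iff)

lemma (in banach_space_over) dual_smul: "f \<in> dual smul \<Longrightarrow> f (smul c x) = c * f x"
  by (auto simp: dual_def Vector_Spaces.linear_iff)

lemma (in banach_space_over) dual_scaleR: "f \<in> dual smul \<Longrightarrow> f (r *\<^sub>R x) = of_real r * f x"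
  using dual_smul[of f "of_real r" x] by (simp add: smul_of_real)

text \<open>Continuity at 0 bounds \<open>f\<close> on a small ball, and real homogeneity extends
  the bound to the whole space. This gives access to \<open>onorm\<close>.\<close>

lemma (in banach_space_over) dual_bounded_linear:
  assumes f: "f \<in> dual smul"
  shows "bounded_linear f"
proof -
  have f0: "f 0 = 0" using dual_add[OF f, of 0 0] by simp
  have "isCont f 0" using f by (simp add: dual_def continuous_on_eq_continuous_at)
  then obtain d where d: "0 < d" "\<And>y. norm y < d \<Longrightarrow> norm (f y) < 1"
    by (auto simp: continuous_at_eps_delta f0 dest: spec[of _ 1])
  show ?thesis
  proof (rule bounded_linear_intro)
    fix x
    show "norm (f x) \<le> norm x * (2 / d)"
    proof (cases "x = 0")
      case False
      \<comment> \<open>This scales \<open>x\<close> to norm \<open>d / 2\<close>, inside the ball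
        where \<open>f\<close> stays below 1.\<close>
      define t where "t = d / (2 * norm x)"
      have t: "0 < t" using d(1) False by (simp add: t_def)
      have "norm (t *\<^sub>R x) < d" using t d(1) False by (simp add: t_def)
      then have "t * norm (f x) < 1"
        using d(2)[of "t *\<^sub>R x"] t by (simp add: dual_scaleR[OF f] norm_mult)
      then show ?thesis using d(1) False by (simp add: t_def field_simps)
    qed (simp add: f0)
  qed (simp_all add: dual_add[OF f] dual_scaleR[OF f] scaleR_conv_of_real)
qed

lemma (in banach_space_over) dualI:
  assumes add: "\<And>x y. f (x + y) = f x + f y" and scale: "\<And>c x. f (smul c x) = c * f x"
    and bound: "\<And>x. norm (f x) \<le> norm x * K"
  shows "f \<in> dual smul"
proof -
  have "bounded_linear f"
    using scale[of "of_real _"]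
    by (intro bounded_linear_intro[where K = K] add bound)
      (simp add: smul_of_real scaleR_conv_of_real)
  then have "continuous_on UNIV f" by (intro linear_continuous_on)
  moreover have "Vector_Spaces.linear smul (*) f"
    unfolding Vector_Spaces.linear_iff
    using vector_space_axioms vector_space_over_itself.vector_space_axioms add scale by auto
  ultimately show ?thesis by (simp add: dual_def)
qed

section \<open>The space of weak* sequences: finite norms and completeness\<close>

locale lambda_sequences =
  banach_space_over smul + normal_AK_BK_space \<Lambda> N
  for smul :: "'k::{real_normed_field, banach} \<Rightarrow> 'x::banach \<Rightarrow> 'x"
    and \<Lambda> :: "(nat \<Rightarrow> 'k) set" and N :: "(nat \<Rightarrow> 'k) \<Rightarrow> real"
begin

abbreviation W :: "(nat \<Rightarrow> 'x \<Rightarrow> 'k) set" where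
  "W \<equiv> weakstar_seqs \<Lambda> smul"

lemma W_dual: "f \<in> W \<Longrightarrow> f j \<in> dual smul"
  by (simp add: weakstar_seqs_def)

lemma W_values: "f \<in> W \<Longrightarrow> (\<lambda>j. f j x) \<in> \<Lambda>"
  by (simp add: weakstar_seqs_def)

lemma W_values_add: "f \<in> W \<Longrightarrow> (\<lambda>j. f j (x + y)) = (\<lambda>j. f j x) + (\<lambda>j. f j y)"
  by (auto simp: fun_eq_iff dual_add W_dual)

lemma W_values_smul: "f \<in> W \<Longrightarrow> (\<lambda>j. f j (smul c x)) = seq_scale c (\<lambda>j. f j x)"
  by (auto simp: fun_eq_iff dual_smul W_dual seq_scale_def)

lemma W_values_scaleR: "f \<in> W \<Longrightarrow> (\<lambda>j. f j (r *\<^sub>R x)) = seq_scale (of_real r) (\<lambda>j. f j x)"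
  using W_values_smul[of f "of_real r" x] by (simp add: smul_of_real)

lemma W_add:
  assumes "f \<in> W" "g \<in> W"
  shows "f + g \<in> W"
proof -
  have "(\<lambda>x. f j x + g j x) \<in> dual smul" for j
    using W_dual[OF assms(1), of j] W_dual[OF assms(2), of j]
    unfolding dual_def Vector_Spaces.linear_iff
    by (auto simp: algebra_simps intro!: continuous_intros)
  then show ?thesis
    using add_closed[OF W_values[OF assms(1)] W_values[OF assms(2)]]
    by (simp add: weakstar_seqs_def plus_fun_def)
qed

lemma W_scale:
  assumes "f \<in> W"
  shows "(\<lambda>j x. c * f j x) \<in> W"
proof -
  have "(\<lambda>x. c * f j x) \<in> dual smul" for j
    using W_dual[OF assms, of j] unfolding dual_def Vector_Spaces.linear_iff
    by (auto simp: algebra_simps intro!: continuous_intros)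
  then show ?thesis
    using scale_closed[OF W_values[OF assms], of c] by (simp add: weakstar_seqs_def seq_scale_def)
qed

lemma W_diff: "f \<in> W \<Longrightarrow> g \<in> W \<Longrightarrow> f - g \<in> W"
  using W_add[OF _ W_scale, of f g "- 1"] by (simp add: fun_diff_def plus_fun_def)

text \<open>Homogeneity carries the estimate from the unit ball to all of \<open>X\<close>. The
  condition \<open>0 \<le> r\<close> comes from the point 0, and in the converse it bounds
  \<open>r * norm x\<close> by \<open>r\<close> on the ball.\<close>

lemma weakstar_norm_le_iff:
  assumes f: "f \<in> W"
  shows "weakstar_norm N f \<le> ereal r \<longleftrightarrow> 0 \<le> r \<and> (\<forall>x. N (\<lambda>j. f j x) \<le> r * norm x)"
proof
  have *: "N (\<lambda>j. f j (t *\<^sub>R x)) = \<bar>t\<bar> * N (\<lambda>j. f j x)" for t x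
    using W_values_scaleR[OF f, of t x] N_scale[OF W_values[OF f]] by simp
  assume "weakstar_norm N f \<le> ereal r"
  then have r: "N (\<lambda>j. f j x) \<le> r" if "norm x \<le> 1" for x
    using that by (auto simp: weakstar_norm_def SUP_le_iff)
  have "N (\<lambda>j. f j x) \<le> r * norm x" for x
  proof (cases "x = 0")
    case True
    then show ?thesis using *[of 0 x] by simp
  next
    case False
    then show ?thesis using r[of "(1 / norm x) *\<^sub>R x"] *[of "1 / norm x" x]
      by (simp add: field_simps)
  qed
  moreover have "0 \<le> r" using r[of 0] N_nonneg[OF W_values[OF f], of 0] by simp
  ultimately show "0 \<le> r \<and> (\<forall>x. N (\<lambda>j. f j x) \<le> r * norm x)" by blast
next
  assume r: "0 \<le> r \<and> (\<forall>x. N (\<lambda>j. f j x) \<le> r * norm x)"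
  then have "N (\<lambda>j. f j x) \<le> r" if "norm x \<le> 1" for x
    using mult_left_le[OF that, of r] order_trans by blast
  then show "weakstar_norm N f \<le> ereal r"
    by (auto simp: weakstar_norm_def SUP_le_iff)
qed

text \<open>Apply \<open>gliding_hump\<close> on \<open>X\<close> to the truncated norms
  \<open>q m\<close>: each is controlled by finitely many operator norms, and at a fixed
  \<open>x\<close> all are at most \<open>N (\<lambda>j. f j x)\<close>.\<close>

lemma W_bounded:
  assumes f: "f \<in> W"
  shows "\<exists>r. weakstar_norm N f \<le> ereal r"
proof -
  define q where "q m x = N (truncation m (\<lambda>j. f j x))" for m x
  have "\<exists>r>0. \<exists>K. \<forall>v\<in>UNIV. ereal (norm v) \<le> ereal r \<longrightarrow> (\<forall>m. q m v \<le> K)"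
  proof (rule gliding_hump[where C = "\<lambda>m. \<Sum>j<m. onorm (f j) * N (unit_seq j)"])
    fix x :: "nat \<Rightarrow> 'x" and d :: "nat \<Rightarrow> real"
    assume le: "\<And>m n. n \<le> m \<Longrightarrow> ereal (norm (x m - x n)) \<le> ereal (d n)" and d: "d \<longlonglongrightarrow> 0"
    have "Cauchy x"
    proof (rule metric_CauchyI)
      fix e :: real assume "0 < e"
      then obtain k where k: "\<And>n. n \<ge> k \<Longrightarrow> d n < e"
        using order_tendstoD(2)[OF d] by (auto simp: eventually_sequentially)
      have "dist (x m) (x n) < e" if "k \<le> m" "k \<le> n" for m n
        using that le[of n m] le[of m n] k[of m] k[of n]
        by (cases "n \<le> m") (auto simp: dist_norm norm_minus_commute)
      then show "\<exists>k. \<forall>m\<ge>k. \<forall>n\<ge>k. dist (x m) (x n) < e" by blast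
    qed
    then obtain l where l: "x \<longlonglongrightarrow> l" using Cauchy_convergent_iff convergentD by blast
    have "norm (l - x n) \<le> d n" for n
    proof (rule LIMSEQ_le_const2)
      show "(\<lambda>m. norm (x m - x n)) \<longlonglongrightarrow> norm (l - x n)" by (intro tendsto_intros l)
      show "\<exists>k. \<forall>m\<ge>k. norm (x m - x n) \<le> d n" using le by auto
    qed
    then show "\<exists>l\<in>UNIV. \<forall>n. ereal (norm (l - x n)) \<le> ereal (d n)" by auto
  next
    fix m x y
    show "q m (x + y) \<le> q m x + q m y"
      unfolding q_def W_values_add[OF f] truncation_add by (intro N_triangle truncation_closed)
  next
    fix m x
    show "q m (- x) = q m x"
      unfolding q_def
      using W_values_scaleR[OF f, of "- 1" x]
      by (intro N_cong_norm truncation_closed) (auto simp: truncation_def seq_scale_def fun_eq_iff)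
  next
    fix m and x :: 'x and r :: real assume r: "ereal (norm x) \<le> ereal r"
    have "q m x \<le> (\<Sum>j<m. norm (f j x) * N (unit_seq j))"
      unfolding q_def by (rule N_truncation_le_sum)
    also have "\<dots> \<le> (\<Sum>j<m. onorm (f j) * N (unit_seq j) * r)"
    proof (rule sum_mono)
      fix j
      have b: "bounded_linear (f j)" using W_dual[OF f] by (rule dual_bounded_linear)
      have "norm (f j x) \<le> onorm (f j) * r"
        using onorm[OF b, of x] mult_left_mono[OF _ onorm_pos_le[OF b], of "norm x" r] r by simp
      then show "norm (f j x) * N (unit_seq j) \<le> onorm (f j) * N (unit_seq j) * r"
        using mult_right_mono[OF _ less_imp_le[OF N_unit], of _ _ j] by (fastforce simp: ac_simps)
    qed
    finally show "q m x \<le> (\<Sum>j<m. onorm (f j) * N (unit_seq j)) * r"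
      by (simp add: sum_distrib_right)
  next
    fix x
    show "\<exists>b. \<forall>m. q m x \<le> b" using N_truncation_le[OF W_values[OF f]] by (auto simp: q_def)
  qed (auto intro: norm_triangle_mono simp: zero_ereal_def)
  then obtain r K where r: "0 < r" and K: "\<And>(x :: 'x) m. norm x \<le> r \<Longrightarrow> q m x \<le> K" by auto
  \<comment> \<open>Multiplication by \<open>r\<close> moves the unit ball into the ball where the
    truncations are bounded by \<open>K\<close>.\<close>
  have "N (\<lambda>j. f j x) \<le> K / r" if "norm x \<le> 1" for x :: 'x
  proof -
    have "N (\<lambda>j. f j (r *\<^sub>R x)) \<le> K"
    proof (rule N_le_if_truncations_le[OF W_values[OF f]])
      show "N (truncation m (\<lambda>j. f j (r *\<^sub>R x))) \<le> K" for m
        using K[of "r *\<^sub>R x" m] r that by (simp add: q_def mult_left_le)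
    qed
    moreover have "N (\<lambda>j. f j (r *\<^sub>R x)) = r * N (\<lambda>j. f j x)"
      unfolding W_values_scaleR[OF f] using N_scale[OF W_values[OF f]] r by simp
    ultimately show ?thesis using r by (simp add: field_simps)
  qed
  then show ?thesis by (auto simp: weakstar_norm_def SUP_le_iff intro!: exI[of _ "K / r"])
qed

text \<open>At each \<open>x\<close> the value sequences are Cauchy in \<Lambda> with rate
  \<open>d n * norm x\<close>, so a pointwise limit exists; convergence of coordinates makes it
  linear in \<open>x\<close>.\<close>

lemma W_complete:
  fixes f :: "nat \<Rightarrow> nat \<Rightarrow> 'x \<Rightarrow> 'k"
  assumes f: "\<And>n. f n \<in> W"
    and cauchy: "\<And>m n. n \<le> m \<Longrightarrow> weakstar_norm N (f m - f n) \<le> ereal (d n)"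
    and d: "d \<longlonglongrightarrow> 0"
  shows "\<exists>l\<in>W. \<forall>n. weakstar_norm N (l - f n) \<le> ereal (d n)"
proof -
  have "\<exists>l\<in>\<Lambda>. (\<forall>n. N (l - (\<lambda>j. f n j x)) \<le> d n * norm x)
      \<and> (\<forall>j. (\<lambda>n. f n j x) \<longlonglongrightarrow> l j)" for x :: 'x
  proof (rule complete_with_rate)
    show "(\<lambda>n. d n * norm x) \<longlonglongrightarrow> 0" using d by (rule tendsto_mult_left_zero)
    fix m n :: nat assume "n \<le> m"
    then show "N ((\<lambda>j. f m j x) - (\<lambda>j. f n j x)) \<le> d n * norm x"
      using cauchy weakstar_norm_le_iff[OF W_diff[OF f f]] by (simp add: fun_diff_def)
  qed (rule W_values[OF f])
  then obtain L where L: "\<And>x. L x \<in> \<Lambda>" "\<And>x n. N (L x - (\<lambda>j. f n j x)) \<le> d n * norm x"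
      "\<And>x j. (\<lambda>n. f n j x) \<longlonglongrightarrow> L x j"
    by metis
  define l where "l j x = L x j" for j x
  \<comment> \<open>A bound on \<open>f 0\<close> together with its distance \<open>d 0\<close> from
    the limit shows that the limit functionals are bounded.\<close>
  obtain r where r: "weakstar_norm N (f 0) \<le> ereal r" using W_bounded[OF f] by blast
  have "l j \<in> dual smul" for j
  proof (rule dualI)
    fix x y c
    show "l j (x + y) = l j x + l j y"
    proof (rule LIMSEQ_unique)
      show "(\<lambda>n. f n j (x + y)) \<longlonglongrightarrow> l j (x + y)" unfolding l_def by (rule L)
      show "(\<lambda>n. f n j (x + y)) \<longlonglongrightarrow> l j x + l j y"
        unfolding l_def dual_add[OF W_dual[OF f]] by (intro tendsto_add L)
    qed
    show "l j (smul c x) = c * l j x"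
    proof (rule LIMSEQ_unique)
      show "(\<lambda>n. f n j (smul c x)) \<longlonglongrightarrow> l j (smul c x)" unfolding l_def by (rule L)
      show "(\<lambda>n. f n j (smul c x)) \<longlonglongrightarrow> c * l j x"
        unfolding l_def dual_smul[OF W_dual[OF f]] by (intro tendsto_mult_left L)
    qed
    have "N (L x - (\<lambda>j. f 0 j x) + (\<lambda>j. f 0 j x)) \<le> d 0 * norm x + r * norm x"
      using N_triangle[OF diff_closed[OF L(1) W_values[OF f]] W_values[OF f], of x 0 x 0 x]
        L(2)[of x 0] r[unfolded weakstar_norm_le_iff[OF f], THEN conjunct2, rule_format, of x]
      by (meson add_mono order_trans)
    then have "norm (l j x) * N (unit_seq j) \<le> (d 0 + r) * norm x"
      using coordinate_le[OF L(1), of x j] by (simp add: l_def algebra_simps)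
    then show "norm (l j x) \<le> norm x * ((d 0 + r) / N (unit_seq j))"
      using N_unit[of j] by (simp add: field_simps)
  qed
  then have lW: "l \<in> W" using L(1) by (simp add: weakstar_seqs_def l_def)
  \<comment> \<open>The diagonal case of the Cauchy condition supplies
    \<open>0 \<le> d n\<close>.\<close>
  moreover have "weakstar_norm N (l - f n) \<le> ereal (d n)" for n
    using L(2)[of _ n] cauchy[of n n, unfolded weakstar_norm_le_iff[OF W_diff[OF f f]]]
    unfolding weakstar_norm_le_iff[OF W_diff[OF lW f]]
    by (simp add: fun_diff_def l_def)
  ultimately show ?thesis by blast
qed

section \<open>The two inclusions and their norm bounds\<close>

lemma strong_imp_mid:
  assumes x: "x \<in> strong_seqs \<Lambda> UNIV norm"
  shows "x \<in> mid_seqs \<Lambda> N smul"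
    and "mid_norm \<Lambda> N smul x \<le> ereal (strong_norm N norm x)"
proof -
  have xs: "(\<lambda>n. of_real (norm (x n))) \<in> \<Lambda>" using x by (simp add: strong_seqs_def)
  have dom: "seq_scale (of_real r) (\<lambda>n. of_real (norm (x n))) \<in> \<Lambda>" for r
    using xs by (rule scale_closed)
  \<comment> \<open>This serves twice: with the bound \<open>r\<close> from \<open>W_bounded\<close>
    for membership, and with \<open>r = 1\<close> for the norm estimate.\<close>
  have le: "norm (of_real (N (\<lambda>j. f j (x n))) :: 'k)
      \<le> norm (seq_scale (of_real r) (\<lambda>n. of_real (norm (x n))) n :: 'k)"
    if "f \<in> W" "weakstar_norm N f \<le> ereal r" for f r n
    using that(2)[unfolded weakstar_norm_le_iff[OF that(1)], THEN conjunct2, rule_format, of "x n"]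
      N_nonneg[OF W_values[OF that(1)], of "x n"]
      mult_right_mono[OF abs_ge_self[of r], of "norm (x n)"]
    by (simp add: seq_scale_def norm_mult)
  show "x \<in> mid_seqs \<Lambda> N smul"
    unfolding mid_seqs_def strong_seqs_def
  proof (intro CollectI ballI conjI allI)
    fix f assume f: "f \<in> W"
    then obtain r where "weakstar_norm N f \<le> ereal r" using W_bounded by blast
    from normal[OF dom le[OF f this]] show "(\<lambda>n. of_real (N (\<lambda>j. f j (x n)))) \<in> \<Lambda>" by simp
  qed (rule W_values)
  have "strong_norm N N (\<lambda>n j. f j (x n)) \<le> strong_norm N norm x"
    if "f \<in> W" "weakstar_norm N f \<le> 1" for f
    unfolding strong_norm_def using N_le[OF dom le[of f 1]] that
    by (simp add: seq_scale_def one_ereal_def)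
  then show "mid_norm \<Lambda> N smul x \<le> ereal (strong_norm N norm x)"
    by (auto simp: mid_norm_def SUP_le_iff)
qed

text \<open>Testing the mid condition at the weak* sequence \<open>g f\<close> recovers
  \<open>f\<close>: the value sequence of \<open>g f\<close> at \<open>y\<close> has norm
  \<open>norm (f y)\<close>, so \<open>g f\<close> lies in the unit ball when \<open>f\<close>
  does.\<close>

lemma mid_imp_weak:
  assumes x: "x \<in> mid_seqs \<Lambda> N smul"
  shows "x \<in> weak_seqs \<Lambda> smul" and "weak_norm N smul x \<le> mid_norm \<Lambda> N smul x"
proof -
  \<comment> \<open>This normalises the unit vector at index 0 to norm 1.\<close>
  define c :: 'k where "c = of_real (1 / N (unit_seq 0))"
  define g where "g f j y = (c * f y) * unit_seq 0 j" for f :: "'x \<Rightarrow> 'k" and j :: nat and y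
  have g_values: "(\<lambda>j. g f j y) = seq_scale (c * f y) (unit_seq 0)" for f y
    by (simp add: g_def seq_scale_def)
  have gN: "N (\<lambda>j. g f j y) = norm (f y)" for f y
    unfolding g_values N_scale[OF unit_closed] using N_unit[of 0]
    by (simp add: c_def norm_mult norm_divide)
  have gW: "g f \<in> W" if f: "f \<in> dual smul" for f
    unfolding weakstar_seqs_def
  proof (intro CollectI conjI allI)
    fix j
    show "g f j \<in> dual smul"
      using f unfolding dual_def Vector_Spaces.linear_iff g_def
      by (auto simp: algebra_simps intro!: continuous_intros)
    show "(\<lambda>j. g f j y) \<in> \<Lambda>" for y unfolding g_values by (intro scale_closed unit_closed)
  qed
  have *: "(\<lambda>n. of_real (norm (f (x n)))) \<in> \<Lambda>" if "f \<in> dual smul" for f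
    using x gW[OF that] by (auto simp: mid_seqs_def strong_seqs_def gN dest!: bspec)
  \<comment> \<open>Normality passes from the absolute values of \<open>f (x n)\<close> to the
    values themselves.\<close>
  show "x \<in> weak_seqs \<Lambda> smul"
    using normal[OF *] by (simp add: weak_seqs_def)
  show "weak_norm N smul x \<le> mid_norm \<Lambda> N smul x"
    unfolding weak_norm_def
  proof (rule SUP_least)
    fix f assume "f \<in> {f \<in> dual smul. onorm f \<le> 1}"
    then have f: "f \<in> dual smul" "onorm f \<le> 1" by auto
    have "norm (f y) \<le> 1 * norm y" for y
      using onorm[OF dual_bounded_linear[OF f(1)], of y] f(2) mult_right_mono[of "onorm f" 1 "norm y"]
      by simp
    then have "weakstar_norm N (g f) \<le> 1"
      using weakstar_norm_le_iff[OF gW[OF f(1)], of 1] by (simp add: gN one_ereal_def)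
    then have "ereal (strong_norm N N (\<lambda>n j. g f j (x n))) \<le> mid_norm \<Lambda> N smul x"
      unfolding mid_norm_def using gW[OF f(1)] by (intro SUP_upper) auto
    moreover have "N (\<lambda>n. f (x n)) = N (\<lambda>n. of_real (norm (f (x n))))"
      using *[OF f(1)] by (intro N_cong_norm) auto
    ultimately show "ereal (N (\<lambda>n. f (x n))) \<le> mid_norm \<Lambda> N smul x"
      by (simp add: strong_norm_def gN)
  qed
qed

section \<open>Finiteness of the mid norm\<close>

text \<open>Now \<open>gliding_hump\<close> runs on \<open>W\<close>, complete by
  \<open>W_complete\<close>, with the norms of truncations of \<open>p f\<close>; for fixed
  \<open>f\<close> they are at most \<open>N (p f)\<close>, where \<open>p f\<close> lies in
  \<Lambda> by the mid condition.\<close>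

lemma mid_norm_finite:
  assumes x: "x \<in> mid_seqs \<Lambda> N smul"
  shows "mid_norm \<Lambda> N smul x < \<infinity>"
proof -
  define p where "p f n = (of_real (N (\<lambda>j. f j (x n))) :: 'k)" for f n
  have p: "p f \<in> \<Lambda>" if "f \<in> W" for f
    using x that by (auto simp: mid_seqs_def strong_seqs_def p_def[abs_def])
  have norm_p: "norm (p f n) = N (\<lambda>j. f j (x n))" if "f \<in> W" for f n
    using N_nonneg[OF W_values[OF that]] by (simp add: p_def)
  define q where "q m f = N (truncation m (p f))" for m f
  have "\<exists>r>0. \<exists>K. \<forall>f\<in>W. weakstar_norm N f \<le> ereal r \<longrightarrow> (\<forall>m. q m f \<le> K)"
  proof (rule gliding_hump[where C = "\<lambda>m. \<Sum>n<m. norm (x n) * N (unit_seq n)"])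
    fix u v :: "nat \<Rightarrow> 'x \<Rightarrow> 'k" and r s :: real
    assume uv: "u \<in> W" "v \<in> W" "weakstar_norm N u \<le> ereal r" "weakstar_norm N v \<le> ereal s"
    have "N (\<lambda>j. (u + v) j y) \<le> (r + s) * norm y" for y
      using N_triangle[OF W_values W_values, OF uv(1,2), of y y]
        uv(3)[unfolded weakstar_norm_le_iff[OF uv(1)], THEN conjunct2, rule_format, of y]
        uv(4)[unfolded weakstar_norm_le_iff[OF uv(2)], THEN conjunct2, rule_format, of y]
      by (simp add: plus_fun_def algebra_simps)
    then show "weakstar_norm N (u + v) \<le> ereal (r + s)"
      using uv(3,4) by (simp add: weakstar_norm_le_iff W_add uv(1,2))
  next
    fix m u v assume uv: "u \<in> W" "v \<in> W"
    \<comment> \<open>The map \<open>p\<close> is only subadditive. Its entries are nonnegative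
      reals, so the norm of \<open>p u n + p v n\<close> is the sum of the two norms, and
      monotonicity of \<open>N\<close> then gives subadditivity of \<open>q m\<close>.\<close>
    have "norm (p (u + v) n) \<le> norm (p u n + p v n)" for n
    proof -
      have "norm (p (u + v) n) \<le> N (\<lambda>j. u j (x n)) + N (\<lambda>j. v j (x n))"
        using N_triangle[OF W_values W_values, OF uv, of "x n" "x n"]
        unfolding norm_p[OF W_add[OF uv]] by (simp add: plus_fun_def)
      also have "\<dots> = norm (p u n + p v n)"
        using N_nonneg[OF W_values, OF uv(1), of "x n"] N_nonneg[OF W_values, OF uv(2), of "x n"]
        by (simp add: p_def norm_of_real abs_of_nonneg flip: of_real_add)
      finally show ?thesis .
    qed
    then have "q m (u + v) \<le> N (truncation m (p u + p v))"
      unfolding q_def by (intro N_le truncation_closed) (auto simp: truncation_def)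
    also have "\<dots> \<le> q m u + q m v"
      unfolding truncation_add q_def by (intro N_triangle truncation_closed)
    finally show "q m (u + v) \<le> q m u + q m v" .
  next
    fix m f assume f: "f \<in> W"
    have "(\<lambda>j. (- f) j (x n)) = - (\<lambda>j. f j (x n))" for n by (simp add: fun_eq_iff)
    then have "p (- f) = p f" by (auto simp: p_def[abs_def] N_minus W_values f)
    then show "q m (- f) = q m f" by (simp add: q_def)
  next
    fix m f r assume f: "f \<in> W" and r: "weakstar_norm N f \<le> ereal r"
    have "q m f \<le> (\<Sum>n<m. norm (p f n) * N (unit_seq n))"
      unfolding q_def by (rule N_truncation_le_sum)
    also have "\<dots> \<le> (\<Sum>n<m. r * norm (x n) * N (unit_seq n))"
      using r[unfolded weakstar_norm_le_iff[OF f]] N_unit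
      by (intro sum_mono mult_right_mono) (auto simp: norm_p f less_imp_le)
    finally show "q m f \<le> (\<Sum>n<m. norm (x n) * N (unit_seq n)) * r"
      by (simp add: sum_distrib_left ac_simps)
  next
    fix f assume "f \<in> W"
    then show "\<exists>b. \<forall>m. q m f \<le> b" using N_truncation_le[OF p] by (auto simp: q_def)
  next
    show "weakstar_norm N (0 :: nat \<Rightarrow> 'x \<Rightarrow> 'k) \<le> 0"
      using N_zero by (auto simp: weakstar_norm_def SUP_le_iff zero_fun_def)
  qed (auto intro: W_add W_diff W_complete)
  then obtain r K where r: "0 < r"
    and K: "\<And>f m. f \<in> W \<Longrightarrow> weakstar_norm N f \<le> ereal r \<Longrightarrow> q m f \<le> K"
    by blast
  have "strong_norm N N (\<lambda>n j. f j (x n)) \<le> K / r" if f: "f \<in> W" "weakstar_norm N f \<le> 1" for f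
  proof -
    \<comment> \<open>The multiple of \<open>f\<close> by \<open>r\<close> falls into the ball on
      which \<open>K\<close> is a bound, and \<open>p\<close> is homogeneous for positive
      factors.\<close>
    define g where "g j y = of_real r * f j y" for j y
    have g: "g \<in> W" unfolding g_def[abs_def] using f(1) by (rule W_scale)
    have gN: "N (\<lambda>j. g j y) = r * N (\<lambda>j. f j y)" for y
      using N_scale[OF W_values[OF f(1)], of "of_real r" y] r by (simp add: g_def seq_scale_def)
    have "weakstar_norm N g \<le> ereal r"
      using f(2) r weakstar_norm_le_iff[OF f(1), of 1]
      by (simp add: weakstar_norm_le_iff[OF g] gN one_ereal_def)
    then have "N (p g) \<le> K"
      using N_le_if_truncations_le[OF p[OF g]] K[OF g] by (simp add: q_def)
    moreover have "p g = seq_scale (of_real r) (p f)"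
      by (simp add: p_def[abs_def] gN seq_scale_def)
    ultimately show ?thesis
      using r N_scale[OF p[OF f(1)], of "of_real r"]
      by (simp add: strong_norm_def p_def[abs_def] field_simps)
  qed
  then have "mid_norm \<Lambda> N smul x \<le> ereal (K / r)"
    by (auto simp: mid_norm_def SUP_le_iff)
  then show ?thesis by (rule order.strict_trans1) simp
qed

end

theorem proposition3p5:
  fixes \<Lambda> :: "(nat \<Rightarrow> 'k::{real_normed_field, banach}) set"
    and N :: "(nat \<Rightarrow> 'k) \<Rightarrow> real"
    and smul :: "'k \<Rightarrow> 'x::banach \<Rightarrow> 'x"
  assumes "banach_space_over smul"
    and "normal_AK_BK_space \<Lambda> N"
  shows "strong_seqs \<Lambda> UNIV norm \<subseteq> mid_seqs \<Lambda> N smul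
    \<and> mid_seqs \<Lambda> N smul \<subseteq> weak_seqs \<Lambda> smul
    \<and> (\<forall>x \<in> strong_seqs \<Lambda> UNIV norm. mid_norm \<Lambda> N smul x \<le> ereal (strong_norm N norm x))
    \<and> (\<forall>x \<in> mid_seqs \<Lambda> N smul. weak_norm N smul x \<le> mid_norm \<Lambda> N smul x
          \<and> mid_norm \<Lambda> N smul x < \<infinity>)"
proof -
  interpret lambda_sequences smul \<Lambda> N
    using assms by (simp add: lambda_sequences_def)
  show ?thesis
    using strong_imp_mid mid_imp_weak mid_norm_finite by blast
qed

end
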